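(* Let $d\ge1$. For any $x\preceq y$ in $P_d$, the interval $[x,y]=\{z\in P_d:x\preceq z\preceq y\}$ is canonically isomorphic (as a partially ordered set) to the Boolean lattice $2^{D(x,y)}$ of subsets of $D(x,y)$, ordered by inclusion, where $D(x,y)=\{i\in[d]:x_i=\mathrm M,\ y_i\ne\mathrm M\}$.
   Context: $[d]=\{1,\dots,d\}$. Let $E=\{\mathrm M,\mathrm L,\mathrm U\}$ with the partial order $\mathrm M\prec\mathrm L$, $\mathrm M\prec\mathrm U$, and $\mathrm L,\mathrm U$ incomparable. $P_d=E^d$ carries the product order $\preceq$. The canonical identification sends $z\in[x,y]$ to $\{i\in D(x,y):z_i=y_i\}$. *)

theory Defs
  imports "HOL-Library.FuncSet"
begin

datatype E = E_M | E_L | E_U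

instantiation E :: order
begin

definition less_eq_E :: "E \<Rightarrow> E \<Rightarrow> bool" where
  "a \<le> b \<longleftrightarrow> a = b \<or> (a = E_M \<and> b = E_L) \<or> (a = E_M \<and> b = E_U)"

definition less_E :: "E \<Rightarrow> E \<Rightarrow> bool" where
  "a < b \<longleftrightarrow> a \<le> b \<and> \<not> b \<le> (a :: E)"

instance
  by standard (auto simp: less_eq_E_def less_E_def)

end

text \<open>Points of \<open>E\<^sup>d\<close> are functions on \<open>{1..d}\<close>, made extensional (with value
  \<^const>\<open>undefined\<close> outside \<open>{1..d}\<close>) so that equality of functions is equality of
  all \<open>d\<close> coordinates.\<close>

definition P :: "nat \<Rightarrow> (nat \<Rightarrow> E) set" where
  "P d = {1..d} \<rightarrow>\<^sub>E UNIV"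

definition prod_le :: "nat \<Rightarrow> (nat \<Rightarrow> E) \<Rightarrow> (nat \<Rightarrow> E) \<Rightarrow> bool" where
  "prod_le d x y \<longleftrightarrow> (\<forall>i\<in>{1..d}. x i \<le> y i)"

definition interval :: "nat \<Rightarrow> (nat \<Rightarrow> E) \<Rightarrow> (nat \<Rightarrow> E) \<Rightarrow> (nat \<Rightarrow> E) set" where
  "interval d x y = {z \<in> P d. prod_le d x z \<and> prod_le d z y}"

definition D :: "nat \<Rightarrow> (nat \<Rightarrow> E) \<Rightarrow> (nat \<Rightarrow> E) \<Rightarrow> nat set" where
  "D d x y = {i \<in> {1..d}. x i = E_M \<and> y i \<noteq> E_M}"

definition canonical_map :: "nat \<Rightarrow> (nat \<Rightarrow> E) \<Rightarrow> (nat \<Rightarrow> E) \<Rightarrow> (nat \<Rightarrow> E) \<Rightarrow> nat set" where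
  "canonical_map d x y z = {i \<in> D d x y. z i = y i}"

definition poset_on :: "'a set \<Rightarrow> ('a \<Rightarrow> 'a \<Rightarrow> bool) \<Rightarrow> bool" where
  "poset_on A le \<longleftrightarrow> reflp_on A le \<and> antisymp_on A le \<and> transp_on A le"

definition poset_iso ::
  "'a set \<Rightarrow> ('a \<Rightarrow> 'a \<Rightarrow> bool) \<Rightarrow> 'b set \<Rightarrow> ('b \<Rightarrow> 'b \<Rightarrow> bool) \<Rightarrow> ('a \<Rightarrow> 'b) \<Rightarrow> bool" where
  "poset_iso A leA B leB f \<longleftrightarrow>
     poset_on A leA \<and> poset_on B leB \<and> bij_betw f A B \<and>
     (\<forall>a\<in>A. \<forall>b\<in>A. leA a b \<longleftrightarrow> leB (f a) (f b))"

end

theory Submission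
  imports Defs
begin

text \<open>
  Every chain in \<open>E\<close> has at most two elements, with \<^const>\<open>E_M\<close> at the bottom. Hence
  in a coordinate \<open>i\<close> the interval between \<open>x i\<close> and \<open>y i\<close> is a single point unless
  \<open>i \<in> D d x y\<close>, and then it is the two-element chain \<open>{E_M, y i}\<close>. So the interval
  \<open>[x, y]\<close> is a product of two-element chains indexed by \<open>D d x y\<close>, that is, a Boolean
  lattice: a point \<open>z\<close> amounts to the free choice of the set of coordinates in which it takes
  the upper value. The lemma \<open>interval_coordinate\<close> makes this precise by recovering \<open>z\<close> from that
  set. The order claim also follows from it, since a comparison in \<open>E_M < y i\<close> is an
  implication between membership statements.
\<close>

lemma E_M_le: "E_M \<le> c"
  by (cases c) (simp_all add: less_eq_E_def)

text \<open>
  For \<open>i \<in> D d x y\<close>, being below \<open>y i\<close> leaves only \<open>E_M\<close> and \<open>y i\<close>. For any other \<open>i\<close>,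
  \<open>x i \<le> y i\<close> forces \<open>x i = y i\<close>, and \<open>z i\<close> is squeezed between them.
\<close>

lemma interval_coordinate:
  assumes "z \<in> interval d x y" and "i \<in> {1..d}"
  shows "z i = (if i \<in> D d x y - canonical_map d x y z then E_M else y i)"
proof -
  have "x i \<le> z i" "z i \<le> y i"
    using assms by (auto simp: interval_def prod_le_def)
  then show ?thesis
    using assms(2) by (auto simp: less_eq_E_def D_def canonical_map_def)
qed

text \<open>The inverse of the canonical map.\<close>

definition point_of_subset ::
    "nat \<Rightarrow> (nat \<Rightarrow> E) \<Rightarrow> (nat \<Rightarrow> E) \<Rightarrow> nat set \<Rightarrow> nat \<Rightarrow> E" where
  "point_of_subset d x y S = (\<lambda>i\<in>{1..d}. if i \<in> D d x y - S then E_M else y i)"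

lemma point_of_subset_in_interval:
  assumes "prod_le d x y"
  shows "point_of_subset d x y S \<in> interval d x y"
  using assms
  by (auto simp: point_of_subset_def interval_def P_def prod_le_def D_def less_eq_E_def)

text \<open>
  A subset is recovered because \<open>E_M \<noteq> y i\<close> for \<open>i \<in> D d x y\<close>, so the two available
  values are told apart by comparison with \<open>y i\<close>.
\<close>

lemma canonical_map_point_of_subset:
  assumes "S \<subseteq> D d x y"
  shows "canonical_map d x y (point_of_subset d x y S) = S"
  using assms by (auto simp: canonical_map_def point_of_subset_def D_def)

lemma point_of_subset_canonical_map:
  assumes "z \<in> interval d x y"
  shows "point_of_subset d x y (canonical_map d x y z) = z"
proof (rule extensionalityI[of _ "{1..d}"])
  show "point_of_subset d x y (canonical_map d x y z) \<in> extensional {1..d}"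
    by (simp add: point_of_subset_def)
  show "z \<in> extensional {1..d}"
    using assms by (simp add: interval_def P_def PiE_def)
next
  fix i assume "i \<in> {1..d}"
  then show "point_of_subset d x y (canonical_map d x y z) i = z i"
    using interval_coordinate[OF assms] by (simp add: point_of_subset_def)
qed

lemma bij_betw_canonical_map:
  assumes "prod_le d x y"
  shows "bij_betw (canonical_map d x y) (interval d x y) (Pow (D d x y))"
proof (rule bij_betw_byWitness[where f' = "point_of_subset d x y"])
  show "canonical_map d x y ` interval d x y \<subseteq> Pow (D d x y)"
    by (auto simp: canonical_map_def)
qed (use assms in \<open>auto simp: point_of_subset_canonical_map canonical_map_point_of_subset
       point_of_subset_in_interval\<close>)

lemma prod_le_iff_canonical_map_subset:
  assumes "a \<in> interval d x y" and "b \<in> interval d x y"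
  shows "prod_le d a b \<longleftrightarrow> canonical_map d x y a \<subseteq> canonical_map d x y b"
proof
  assume le: "prod_le d a b"
  show "canonical_map d x y a \<subseteq> canonical_map d x y b"
  proof
    fix i assume "i \<in> canonical_map d x y a"
    then have i: "i \<in> D d x y" "i \<in> {1..d}" "a i = y i"
      by (auto simp: canonical_map_def D_def)
    \<comment> \<open>Here \<open>b i\<close> lies between \<open>a i = y i\<close> and \<open>y i\<close>.\<close>
    have "a i \<le> b i" "b i \<le> y i"
      using le assms(2) i(2) by (auto simp: prod_le_def interval_def)
    then show "i \<in> canonical_map d x y b"
      using i(1,3) by (simp add: canonical_map_def)
  qed
next
  assume "canonical_map d x y a \<subseteq> canonical_map d x y b"
  then show "prod_le d a b"
    unfolding prod_le_def
    using interval_coordinate[OF assms(1)] interval_coordinate[OF assms(2)]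
    by (auto simp: E_M_le)
qed

text \<open>
  Antisymmetry needs points of \<^term>\<open>P d\<close>: the order compares coordinates in \<open>{1..d}\<close> only,
  and extensionality settles the others.
\<close>

lemma poset_on_prod_le: "poset_on (P d) (prod_le d)"
  unfolding poset_on_def
proof (intro conjI)
  show "reflp_on (P d) (prod_le d)"
    by (auto simp: reflp_on_def prod_le_def)
  show "antisymp_on (P d) (prod_le d)"
    unfolding antisymp_on_def P_def prod_le_def by (blast intro: PiE_ext order.antisym)
  show "transp_on (P d) (prod_le d)"
    unfolding transp_on_def prod_le_def by (blast intro: order.trans)
qed

lemma poset_on_subset:
  assumes "poset_on A le" and "B \<subseteq> A"
  shows "poset_on B le"
  using assms unfolding poset_on_def
  by (blast intro: reflp_on_subset antisymp_on_subset transp_on_subset)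

theorem proposition17:
  fixes d :: nat and x y :: "nat \<Rightarrow> E"
  assumes "d \<ge> 1"
    and "x \<in> P d" and "y \<in> P d"
    and "prod_le d x y"
  shows "poset_iso (interval d x y) (prod_le d) (Pow (D d x y)) (\<subseteq>) (canonical_map d x y)"
  unfolding poset_iso_def
proof (intro conjI ballI)
  show "poset_on (interval d x y) (prod_le d)"
    by (rule poset_on_subset[OF poset_on_prod_le]) (auto simp: interval_def)
  show "poset_on (Pow (D d x y)) (\<subseteq>)"
    by (auto simp: poset_on_def reflp_on_def antisymp_on_def transp_on_def)
  show "bij_betw (canonical_map d x y) (interval d x y) (Pow (D d x y))"
    using assms(4) by (rule bij_betw_canonical_map)
qed (rule prod_le_iff_canonical_map_subset)

end
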